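(* Let $I$ be a finite set of players. For each $\nu\in I$ let $X_\nu\subset\mathbb{R}^{n_\nu}$, let $\succeq_\nu$ be a binary relation on $\mathbb{R}^n=\prod_{\nu\in I}\mathbb{R}^{n_\nu}$, and let $K_\nu:X_{-\nu}\rightrightarrows X_\nu$ be a set-valued map, where $X_{-\nu}=\prod_{j\ne\nu}X_j$. Assume that for each $\nu\in I$: (1) $X_\nu$ is non-empty, convex and compact; (2) $K_\nu$ is continuous with non-empty, closed and convex values; (3) $U^s_\nu(x)$ is convex and open for all $x\in\mathbb{R}^n$; (4) $U^s_\nu:\mathbb{R}^n\rightrightarrows\mathbb{R}^{n_\nu}$ is lower hemicontinuous. Then there exists at least one generalized Nash equilibrium.
   Context: Vectors $x\in\mathbb{R}^n$ are written $x=(x^\nu,x^{-\nu})$. The induced relation is $x^\nu\succeq_{\nu,w^{-\nu}}y^\nu$ iff $(x^\nu,w^{-\nu})\succeq_\nu(y^\nu,w^{-\nu})$, with asymmetric part $\succ_{\nu,w^{-\nu}}$ ($a\succ b$ iff $a\succeq b$ and not $b\succeq a$). $U^s_\nu(x)=\{y^\nu\in\mathbb{R}^{n_\nu}:y^\nu\succ_{\nu,x^{-\nu}}x^\nu\}$. With $X=\prod_\nu X_\nu$ and $K(x)=\prod_\nu K_\nu(x^{-\nu})$, a point $\hat x\in K(\hat x)$ is a generalized Nash equilibrium if for each $\nu\in I$ there is no $x^\nu\in K_\nu(\hat x^{-\nu})$ with $x^\nu\succ_{\nu,\hat x^{-\nu}}\hat x^\nu$. A set-valued map $F$ is upper hemicontinuous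 at $x$ if for every open $V\supset F(x)$ the set $\{z:F(z)\subset V\}$ is a neighborhood of $x$; lower hemicontinuous at $x$ if for every open $V$ with $V\cap F(x)\neq\emptyset$ the set $\{z:F(z)\cap V\ne\emptyset\}$ is a neighborhood of $x$; continuous if both, at every point. *)

theory Defs
  imports "HOL-Analysis.Analysis"
begin

text \<open>Conventions. The players form a finite set I. The Euclidean space R^k is
  represented, as in the library theory Abstract_Euclidean_Space, by the topology
  Euclidean_space k on functions nat => real vanishing from index k on.
  A strategy profile x in R^n = prod_{nu in I} R^{n_nu} is a function
  'i => (nat => real) in the product topology (extensional outside I).
  The profile (y^nu, w^{-nu}) is w(nu := y); the component x^{-nu} is
  restrict x (I - {nu}).\<close>

type_synonym vec = "nat \<Rightarrow> real"

text \<open>Convexity of a set of vectors (the usual definition, written out since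
  nat => real is not a real_vector instance).\<close>
definition fconvex :: "vec set \<Rightarrow> bool" where
  "fconvex S \<longleftrightarrow> (\<forall>x\<in>S. \<forall>y\<in>S. \<forall>u::real. 0 \<le> u \<and> u \<le> 1 \<longrightarrow>
      (\<lambda>i. (1 - u) * x i + u * y i) \<in> S)"

definition uhc_at :: "'a topology \<Rightarrow> 'b topology \<Rightarrow> ('a \<Rightarrow> 'b set) \<Rightarrow> 'a \<Rightarrow> bool" where
  "uhc_at T S F x \<longleftrightarrow> (\<forall>V. openin S V \<and> F x \<subseteq> V \<longrightarrow>
      (\<exists>U. openin T U \<and> x \<in> U \<and> (\<forall>z\<in>U. F z \<subseteq> V)))"

definition lhc_at :: "'a topology \<Rightarrow> 'b topology \<Rightarrow> ('a \<Rightarrow> 'b set) \<Rightarrow> 'a \<Rightarrow> bool" where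
  "lhc_at T S F x \<longleftrightarrow> (\<forall>V. openin S V \<and> V \<inter> F x \<noteq> {} \<longrightarrow>
      (\<exists>U. openin T U \<and> x \<in> U \<and> (\<forall>z\<in>U. F z \<inter> V \<noteq> {})))"

definition lhc :: "'a topology \<Rightarrow> 'b topology \<Rightarrow> ('a \<Rightarrow> 'b set) \<Rightarrow> bool" where
  "lhc T S F \<longleftrightarrow> (\<forall>x\<in>topspace T. lhc_at T S F x)"

definition hcont :: "'a topology \<Rightarrow> 'b topology \<Rightarrow> ('a \<Rightarrow> 'b set) \<Rightarrow> bool" where
  "hcont T S F \<longleftrightarrow> (\<forall>x\<in>topspace T. uhc_at T S F x \<and> lhc_at T S F x)"

definition prof_top :: "'i set \<Rightarrow> ('i \<Rightarrow> nat) \<Rightarrow> ('i \<Rightarrow> vec) topology" where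
  "prof_top I n = product_topology (\<lambda>\<nu>. Euclidean_space (n \<nu>)) I"

definition strict_pref ::
  "('i \<Rightarrow> ('i \<Rightarrow> vec) \<Rightarrow> ('i \<Rightarrow> vec) \<Rightarrow> bool) \<Rightarrow> 'i \<Rightarrow> ('i \<Rightarrow> vec) \<Rightarrow> vec \<Rightarrow> vec \<Rightarrow> bool" where
  "strict_pref R \<nu> w a b \<longleftrightarrow> R \<nu> (w(\<nu> := a)) (w(\<nu> := b)) \<and> \<not> R \<nu> (w(\<nu> := b)) (w(\<nu> := a))"

definition Us ::
  "('i \<Rightarrow> nat) \<Rightarrow> ('i \<Rightarrow> ('i \<Rightarrow> vec) \<Rightarrow> ('i \<Rightarrow> vec) \<Rightarrow> bool) \<Rightarrow> 'i \<Rightarrow> ('i \<Rightarrow> vec) \<Rightarrow> vec set" where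
  "Us n R \<nu> x = {y \<in> topspace (Euclidean_space (n \<nu>)). strict_pref R \<nu> x y (x \<nu>)}"

definition is_GNE ::
  "'i set \<Rightarrow> ('i \<Rightarrow> vec set) \<Rightarrow> ('i \<Rightarrow> ('i \<Rightarrow> vec) \<Rightarrow> ('i \<Rightarrow> vec) \<Rightarrow> bool)
     \<Rightarrow> ('i \<Rightarrow> ('i \<Rightarrow> vec) \<Rightarrow> vec set) \<Rightarrow> ('i \<Rightarrow> vec) \<Rightarrow> bool" where
  "is_GNE I X R K xh \<longleftrightarrow> xh \<in> PiE I X \<and>
     (\<forall>\<nu>\<in>I. xh \<nu> \<in> K \<nu> (restrict xh (I - {\<nu>}))) \<and>
     (\<forall>\<nu>\<in>I. \<not> (\<exists>y \<in> K \<nu> (restrict xh (I - {\<nu>})). strict_pref R \<nu> xh y (xh \<nu>)))"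

end

theory Submission
  imports Defs
begin

text \<open>
  Lower hemicontinuity with open convex values in finite dimension makes the graph of every
  \<open>Us n R \<nu>\<close> open. Let \<open>f \<nu> z\<close> be a point of \<open>K \<nu> z\<close> at which the distance to the complement of this
  graph is maximal up to a factor 2. By Brouwer's theorem some profile \<open>xh\<close> lies in
  the closed convex hull of the values of \<open>f\<close> at profiles near \<open>xh\<close>. Upper hemicontinuity of \<open>K \<nu>\<close> then
  makes \<open>xh\<close> feasible. If player \<open>\<nu>\<close> had a profitable deviation at \<open>xh\<close>, lower hemicontinuity
  of \<open>K \<nu>\<close> would give a uniform margin near \<open>xh\<close>, so the hull would lie in the convex set
  \<open>Us n R \<nu> xh\<close>, contradicting the irreflexivity of strict preference.
\<close>

subsection \<open>Brouwer's theorem for cubes\<close>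

text \<open>Kuhn's combinatorial lemma on the grid of mesh \<open>1 / p\<close>: label 0 in
  direction \<open>i\<close> marks points that \<open>f\<close> does not move down in that
  direction, label 1 points that it does not move up. A cell carrying both labels in every direction
  supplies \<open>b i\<close> and \<open>c i\<close>.\<close>

lemma kuhn_cube_approx:
  fixes f :: "nat \<Rightarrow> (nat \<Rightarrow> real) \<Rightarrow> real"
  assumes f01: "\<And>i x. i < m \<Longrightarrow> x \<in> UNIV \<rightarrow> {0..1} \<Longrightarrow> f i x \<in> {0..1}"
    and p: "0 < p"
  obtains a b c where "a \<in> UNIV \<rightarrow> {0..1}"
    and "\<And>i. i < m \<Longrightarrow> b i \<in> UNIV \<rightarrow> {0..1} \<and> c i \<in> UNIV \<rightarrow> {0..1} \<and>
      (\<forall>j. \<bar>b i j - a j\<bar> \<le> 1 / real p \<and> \<bar>c i j - a j\<bar> \<le> 1 / real p) \<and>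
      b i i \<le> f i (b i) \<and> f i (c i) \<le> c i i"
proof -
  \<comment> \<open>The value 0 for out-of-range entries puts \<open>pt v\<close> into the cube for
    every \<open>v\<close>.\<close>
  define pt :: "(nat \<Rightarrow> nat) \<Rightarrow> nat \<Rightarrow> real"
    where "pt v = (\<lambda>j. if j < m \<and> v j \<le> p then real (v j) / real p else 0)" for v
  \<comment> \<open>Kuhn's lemma demands label 1 on the upper faces, so \<open>v i = p\<close> is
    excluded from label 0 even where \<open>f\<close> fixes the coordinate. Since \<open>f\<close>
    stays below 1, label 1 keeps its meaning there.\<close>
  define label :: "(nat \<Rightarrow> nat) \<Rightarrow> nat \<Rightarrow> nat"
    where "label v i = (if pt v i \<le> f i (pt v) \<and> v i \<noteq> p then 0 else 1)" for v i
  have ptQ: "pt v \<in> UNIV \<rightarrow> {0..1}" for v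
    using p by (auto simp: pt_def)
  have fpt: "0 \<le> f i (pt v)" "f i (pt v) \<le> 1" if "i < m" for i v
    using f01[OF that ptQ] by auto
  obtain q where q: "\<forall>i<m. q i < p"
    and qrs: "\<forall>i<m. \<exists>r s. (\<forall>j<m. q j \<le> r j \<and> r j \<le> q j + 1) \<and>
       (\<forall>j<m. q j \<le> s j \<and> s j \<le> q j + 1) \<and> label r i \<noteq> label s i"
  proof (rule kuhn_lemma[of p m label, OF p])
    show "\<forall>x. (\<forall>i<m. x i \<le> p) \<longrightarrow> (\<forall>i<m. x i = 0 \<longrightarrow> label x i = 0)"
      using p fpt by (auto simp: label_def pt_def)
  qed (auto simp: label_def)
  have near: "\<bar>pt r j - pt q j\<bar> \<le> 1 / real p" if "\<forall>j<m. q j \<le> r j \<and> r j \<le> q j + 1" for r j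
  proof (cases "j < m")
    case True
    then have "q j < p" "q j \<le> r j" "r j \<le> q j + 1" using q that by auto
    then have "pt r j - pt q j = (real (r j) - real (q j)) / real p" "\<bar>real (r j) - real (q j)\<bar> \<le> 1"
      using True by (auto simp: pt_def diff_divide_distrib)
    then show ?thesis
      using p by (simp add: divide_right_mono)
  qed (auto simp: pt_def)
  have "\<exists>b c. b \<in> UNIV \<rightarrow> {0..1} \<and> c \<in> UNIV \<rightarrow> {0..1} \<and>
      (\<forall>j. \<bar>b j - pt q j\<bar> \<le> 1 / real p \<and> \<bar>c j - pt q j\<bar> \<le> 1 / real p) \<and>
      b i \<le> f i b \<and> f i c \<le> c i" if i: "i < m" for i
  proof -
    have low: "pt v i \<le> f i (pt v)" if "label v i = 0" for v
      using that by (auto simp: label_def split: if_splits)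
    have high: "f i (pt v) \<le> pt v i" if "label v i \<noteq> 0" for v
    proof (cases "v i = p")
      case True
      then have "pt v i = 1" using i p by (auto simp: pt_def)
      then show ?thesis using fpt i by auto
    qed (use that in \<open>auto simp: label_def split: if_splits\<close>)
    obtain r s where rs: "\<forall>j<m. q j \<le> r j \<and> r j \<le> q j + 1"
       "\<forall>j<m. q j \<le> s j \<and> s j \<le> q j + 1" "label r i \<noteq> label s i"
      using qrs i by blast
    show ?thesis
    proof (cases "label r i = 0")
      case True
      then show ?thesis
        using rs near low high ptQ by (intro exI[of _ "pt r"] exI[of _ "pt s"]) auto
    next
      case False
      then have "label s i = 0" using rs(3) by (auto simp: label_def split: if_splits)
      then show ?thesis
        using rs near low high ptQ False by (intro exI[of _ "pt s"] exI[of _ "pt r"]) auto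
    qed
  qed
  then show thesis
    using that[of "pt q"] ptQ by metis
qed

lemma compact_unit_cube_fun: "compact (UNIV \<rightarrow> {0..1} :: ('a \<Rightarrow> real) set)"
proof -
  have "compactin (product_topology (\<lambda>_. euclideanreal) UNIV) (PiE UNIV (\<lambda>_::'a. {0..1}))"
    by (simp add: compactin_PiE)
  then show ?thesis
    by (simp add: euclidean_product_topology PiE_UNIV_domain Pi_def)
qed

lemma tendsto_fun_iff:
  fixes l :: "'a \<Rightarrow> 'b::topological_space"
  shows "(X \<longlongrightarrow> l) F \<longleftrightarrow> (\<forall>j. ((\<lambda>n. X n j) \<longlongrightarrow> l j) F)"
proof -
  have "(X \<longlongrightarrow> l) F \<longleftrightarrow> limitin (product_topology (\<lambda>_. euclidean) UNIV) X l F"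
    by (simp add: euclidean_product_topology)
  then show ?thesis
    by (simp add: limitin_componentwise)
qed

text \<open>Brouwer's theorem for cubes of arbitrary finite dimension \<open>m\<close>. The library version has the
  dimension in the type, whereas here it must be quantified over.\<close>

lemma brouwer_cube_fun:
  fixes f :: "nat \<Rightarrow> (nat \<Rightarrow> real) \<Rightarrow> real"
  assumes cont: "\<And>i. i < m \<Longrightarrow> continuous_on (UNIV \<rightarrow> {0..1}) (f i)"
    and f01: "\<And>i x. i < m \<Longrightarrow> x \<in> UNIV \<rightarrow> {0..1} \<Longrightarrow> f i x \<in> {0..1}"
  obtains x where "x \<in> UNIV \<rightarrow> {0..1}" and "\<And>i. i < m \<Longrightarrow> f i x = x i"
proof -
  let ?Q = "UNIV \<rightarrow> {0..1} :: (nat \<Rightarrow> real) set"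
  define P where "P N a b c \<longleftrightarrow> a \<in> ?Q \<and> (\<forall>i<m. b i \<in> ?Q \<and> c i \<in> ?Q \<and>
      (\<forall>j. \<bar>b i j - a j\<bar> \<le> 1 / real (Suc N) \<and> \<bar>c i j - a j\<bar> \<le> 1 / real (Suc N)) \<and>
      b i i \<le> f i (b i) \<and> f i (c i) \<le> c i i)" for N a b c
  have "\<exists>a b c. P N a b c" for N
    unfolding P_def by (rule kuhn_cube_approx[of m f "Suc N"]) (use f01 in blast)+
  then obtain a b c where "\<And>N. P N (a N) (b N) (c N)"
    by metis
  then have aQ: "\<And>N. a N \<in> ?Q"
    and bQ: "\<And>N i. i < m \<Longrightarrow> b N i \<in> ?Q" and cQ: "\<And>N i. i < m \<Longrightarrow> c N i \<in> ?Q"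
    and ba: "\<And>N i j. i < m \<Longrightarrow> \<bar>b N i j - a N j\<bar> \<le> 1 / real (Suc N)"
    and ca: "\<And>N i j. i < m \<Longrightarrow> \<bar>c N i j - a N j\<bar> \<le> 1 / real (Suc N)"
    and bf: "\<And>N i. i < m \<Longrightarrow> b N i i \<le> f i (b N i)"
    and cf: "\<And>N i. i < m \<Longrightarrow> f i (c N i) \<le> c N i i"
    by (auto simp: P_def)
  obtain l r where l: "l \<in> ?Q" and r: "strict_mono r" and lim: "(a \<circ> r) \<longlonglongrightarrow> l"
    using seq_compactE[OF compact_imp_seq_compact[OF compact_unit_cube_fun]] aQ by metis
  \<comment> \<open>Points within the shrinking mesh of \<open>a\<close> share its limit along
    \<open>r\<close>, so the \<open>b N i\<close> and \<open>c N i\<close> for all \<open>i\<close>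
    converge to one point \<open>l\<close>.\<close>
  have limd: "(\<lambda>n. d (r n)) \<longlonglongrightarrow> l" 
    if d: "\<And>N j. \<bar>d N j - a N j\<bar> \<le> 1 / real (Suc N)" for d :: "nat \<Rightarrow> nat \<Rightarrow> real"
    unfolding tendsto_fun_iff
  proof
    fix j
    have "(\<lambda>N. 1 / real (Suc N)) \<longlonglongrightarrow> 0"
      using LIMSEQ_inverse_real_of_nat by (simp add: inverse_eq_divide)
    then have "(\<lambda>N. d N j - a N j) \<longlonglongrightarrow> 0"
      by (rule Lim_null_comparison[rotated]) (use d in simp)
    then have "(\<lambda>n. d (r n) j - a (r n) j) \<longlonglongrightarrow> 0"
      using LIMSEQ_subseq_LIMSEQ[OF _ r] by (fastforce simp: o_def)
    moreover have "(\<lambda>n. a (r n) j) \<longlonglongrightarrow> l j"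
      using lim by (simp add: tendsto_fun_iff)
    ultimately show "(\<lambda>n. d (r n) j) \<longlonglongrightarrow> l j"
      using tendsto_add by fastforce
  qed
  have "f i l = l i" if i: "i < m" for i
  proof (rule antisym)
    have *: "(\<lambda>n. f i (d (r n))) \<longlonglongrightarrow> f i l" "(\<lambda>n. d (r n) i) \<longlonglongrightarrow> l i"
      if "\<And>N. d N \<in> ?Q" "\<And>N j. \<bar>d N j - a N j\<bar> \<le> 1 / real (Suc N)" for d :: "nat \<Rightarrow> nat \<Rightarrow> real"
    proof -
      show "(\<lambda>n. f i (d (r n))) \<longlonglongrightarrow> f i l"
        using continuous_on_tendsto_compose[OF cont[OF i] limd[OF that(2)] l] that(1) by simp
      show "(\<lambda>n. d (r n) i) \<longlonglongrightarrow> l i"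
        using limd[OF that(2)] by (simp add: tendsto_fun_iff)
    qed
    \<comment> \<open>By continuity of \<open>f i\<close>, the \<open>c\<close> points give this
      inequality in the limit and the \<open>b\<close> points the reverse one.\<close>
    show "f i l \<le> l i"
      by (rule LIMSEQ_le[OF *[of "\<lambda>N. c N i"]]) (use cQ ca cf i in auto)
    show "l i \<le> f i l"
      by (rule LIMSEQ_le[OF *(2)[of "\<lambda>N. b N i"] *(1)[of "\<lambda>N. b N i"]]) (use bQ ba bf i in auto)
  qed
  with l show thesis using that by blast
qed

subsection \<open>Near-fixed points of arbitrary maps\<close>

text \<open>The functions \<open>c j\<close> act as coordinates on a type without vector space
  structure. This is the l1 distance of the coordinate vectors, in general only a
  pseudometric.\<close>

definition cdist :: "('j \<Rightarrow> 'a \<Rightarrow> real) \<Rightarrow> 'j set \<Rightarrow> 'a \<Rightarrow> 'a \<Rightarrow> real" where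
  "cdist c J x y = (\<Sum>j\<in>J. \<bar>c j x - c j y\<bar>)"

lemma cdist_commute: "cdist c J x y = cdist c J y x"
  by (simp add: cdist_def abs_minus_commute)

lemma cdist_triangle: "cdist c J x z \<le> cdist c J x y + cdist c J y z"
  unfolding cdist_def sum.distrib[symmetric] by (rule sum_mono) simp

text \<open>A partition of unity subordinate to the \<open>e\<close>-balls about the net replaces
  \<open>f\<close> by a continuous map. Brouwer's theorem is applied to the weights, which live in a
  cube, and not to \<open>S\<close> itself; \<open>hull\<close> expresses convexity of
  \<open>S\<close> in coordinates.\<close>

lemma approximate_fixpoint_of_net:
  fixes c :: "'j \<Rightarrow> 'a \<Rightarrow> real" and z :: "nat \<Rightarrow> 'a"
  assumes "S \<noteq> {}"
    and hull: "\<And>A w g. \<lbrakk>finite (A::nat set); \<And>a. a \<in> A \<Longrightarrow> 0 \<le> w a; sum w A = 1; g ` A \<subseteq> S\<rbrakk>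
        \<Longrightarrow> \<exists>p\<in>S. \<forall>j\<in>J. c j p = (\<Sum>a\<in>A. w a * c j (g a))"
    and zS: "\<And>i. i < m \<Longrightarrow> z i \<in> S"
    and net: "\<And>x. x \<in> S \<Longrightarrow> \<exists>i<m. cdist c J x (z i) < e"
    and fS: "\<And>x. x \<in> S \<Longrightarrow> f x \<in> S"
  obtains x w where "x \<in> S" and "\<And>i. i < m \<Longrightarrow> 0 \<le> w i" and "sum w {..<m} = 1"
    and "\<And>i. i < m \<Longrightarrow> 0 < w i \<Longrightarrow> cdist c J x (z i) < e"
    and "\<And>j. j \<in> J \<Longrightarrow> c j x = (\<Sum>i<m. w i * c j (f (z i)))"
proof -
  let ?Q = "UNIV \<rightarrow> {0..1} :: (nat \<Rightarrow> real) set"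
  have m: "0 < m"
    using \<open>S \<noteq> {}\<close> net by fastforce
  \<comment> \<open>\<open>\<sigma>\<close> lists the coordinates of a convex combination of the \<open>f (z i)\<close> for every point of the cube,
    and equals the combination with weights \<open>l\<close> when those sum to 1.\<close>
  define \<sigma> where "\<sigma> j l = ((\<Sum>i<m. l i * c j (f (z i))) + max 0 (1 - sum l {..<m}) * c j (f (z 0)))
      / max 1 (sum l {..<m})" for j l
  define D where "D i l = (\<Sum>j\<in>J. \<bar>\<sigma> j l - c j (z i)\<bar>)" for i l
  \<comment> \<open>\<open>W i\<close> vanishes unless the combination coded by \<open>l\<close> is
    \<open>e\<close>-close to \<open>z i\<close>. Normalised, these functions form the partition of
    unity \<open>F\<close>, evaluated at that combination.\<close>
  define W where "W i l = max 0 (e - D i l)" for i l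
  define F where "F i l = W i l / (\<Sum>i<m. W i l)" for i l
  have point: "\<exists>p\<in>S. \<forall>j\<in>J. c j p = \<sigma> j l" if l: "l \<in> ?Q" for l
  proof -
    \<comment> \<open>These weights underlie \<open>\<sigma>\<close>: a deficit of the sum of
      \<open>l\<close> below 1 goes to index 0, an excess over 1 is divided out.\<close>
    define w where "w i = (l i + (if i = 0 then max 0 (1 - sum l {..<m}) else 0)) / max 1 (sum l {..<m})" for i
    have sumw: "(\<Sum>i<m. w i * h i) = ((\<Sum>i<m. l i * h i) + max 0 (1 - sum l {..<m}) * h 0)
      / max 1 (sum l {..<m})" for h
    proof -
      have "(\<Sum>i<m. w i * h i) = (\<Sum>i<m. l i * h i +
          (if i = 0 then max 0 (1 - sum l {..<m}) * h i else 0)) / max 1 (sum l {..<m})"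
        unfolding sum_divide_distrib w_def by (rule sum.cong) (auto simp: field_simps)
      also have "\<dots> = ((\<Sum>i<m. l i * h i) + max 0 (1 - sum l {..<m}) * h 0) / max 1 (sum l {..<m})"
        using m by (simp add: sum.distrib sum.delta)
      finally show ?thesis .
    qed
    have "0 \<le> w i" for i
      using l by (auto simp: w_def Pi_iff intro!: divide_nonneg_nonneg add_nonneg_nonneg)
    moreover have "sum w {..<m} = 1"
      using sumw[of "\<lambda>_. 1"] by (simp add: max_def)
    ultimately show ?thesis
      using hull[of "{..<m}" w "\<lambda>i. f (z i)"] zS fS by (auto simp: sumw \<sigma>_def)
  qed
  have pos: "0 < (\<Sum>i<m. W i l)" if l: "l \<in> ?Q" for l
  proof -
    obtain p where "p \<in> S" and p: "\<forall>j\<in>J. c j p = \<sigma> j l"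
      using point l by blast
    then obtain i where i: "i < m" "cdist c J p (z i) < e"
      using net by blast
    then have "0 < W i l"
      using p by (simp add: W_def D_def cdist_def)
    then show ?thesis
      using i by (intro sum_pos2[of _ i]) (auto simp: W_def)
  qed
  have contW: "continuous_on ?Q (W i)" for i
    unfolding W_def D_def \<sigma>_def
    by (intro continuous_intros continuous_on_product_then_coordinatewise[of ?Q "\<lambda>x. x"]) auto
  have "continuous_on ?Q (F i)" for i
    unfolding F_def using pos by (intro continuous_intros contW) (auto simp: less_imp_neq[symmetric])
  moreover have "F i l \<in> {0..1}" if "i < m" "l \<in> ?Q" for i l
  proof -
    have "W i l \<le> (\<Sum>i<m. W i l)"
      using that by (intro member_le_sum) (auto simp: W_def)
    then show ?thesis
      using pos[OF that(2)] by (auto simp: F_def W_def)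
  qed
  ultimately obtain l where l: "l \<in> ?Q" and fixl: "\<And>i. i < m \<Longrightarrow> F i l = l i"
    using brouwer_cube_fun[of m F] by blast
  \<comment> \<open>A fixed point of \<open>F\<close> has total weight 1, so both corrections in
    \<open>\<sigma>\<close> disappear and \<open>l\<close> itself is the list of weights.\<close>
  have "sum l {..<m} = (\<Sum>i<m. F i l)"
    using fixl by simp
  also have "\<dots> = 1"
    using pos[OF l] by (simp add: F_def sum_divide_distrib[symmetric])
  finally have sum1: "sum l {..<m} = 1" .
  obtain p where p: "p \<in> S" "\<forall>j\<in>J. c j p = \<sigma> j l"
    using point l by blast
  show thesis
  proof
    show "p \<in> S" "sum l {..<m} = 1" by fact+
    show "0 \<le> l i" for i using l by auto
    show "c j p = (\<Sum>i<m. l i * c j (f (z i)))" if "j \<in> J" for j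
      using p that sum1 by (simp add: \<sigma>_def)
    show "cdist c J p (z i) < e" if "i < m" "0 < l i" for i
    proof (rule ccontr)
      assume "\<not> cdist c J p (z i) < e"
      then have "W i l = 0"
        using p by (simp add: W_def D_def cdist_def)
      then show False
        using fixl[OF that(1)] that(2) by (simp add: F_def)
    qed
  qed
qed

text \<open>Balls of \<open>cdist\<close> are open because the coordinates are continuous. The
  radius may depend on the centre, as the compactness argument for near-fixed points
  requires.\<close>

lemma compactin_finite_cdist_cover:
  fixes c :: "'j \<Rightarrow> 'a \<Rightarrow> real"
  assumes S: "compactin T S" and "finite J"
    and c: "\<And>j. j \<in> J \<Longrightarrow> continuous_map T euclideanreal (c j)"
    and e: "\<And>x. x \<in> S \<Longrightarrow> 0 < e x"
  obtains F where "finite F" "F \<subseteq> S" "\<And>x. x \<in> S \<Longrightarrow> \<exists>y\<in>F. cdist c J x y < e y"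
proof -
  define B where "B y = {x \<in> topspace T. cdist c J x y < e y}" for y
  have "openin T (B y)" for y
  proof -
    have "continuous_map T euclideanreal (\<lambda>x. cdist c J x y)"
      unfolding cdist_def using \<open>finite J\<close> c by (intro continuous_intros) auto
    then have "openin T {x \<in> topspace T. cdist c J x y \<in> {..<e y}}"
      by (rule openin_continuous_map_preimage) auto
    then show ?thesis by (simp add: B_def)
  qed
  moreover have "S \<subseteq> \<Union>(B ` S)"
    using e compactin_subset_topspace[OF S] by (auto simp: B_def cdist_def)
  ultimately obtain \<F> where "finite \<F>" "\<F> \<subseteq> B ` S" "S \<subseteq> \<Union>\<F>"
    using S unfolding compactin_def by (metis (no_types, lifting) imageE)
  then obtain F where "finite F" "F \<subseteq> S" "S \<subseteq> \<Union>(B ` F)"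
    by (metis finite_subset_image)
  then show thesis
    using that by (force simp: B_def)
qed

text \<open>A form of Kakutani's theorem without any continuity assumption.\<close>

lemma near_fixpoint_of_arbitrary_map:
  fixes c :: "'j \<Rightarrow> 'a \<Rightarrow> real"
  assumes S: "compactin T S" "S \<noteq> {}" and J: "finite J"
    and c: "\<And>j. j \<in> J \<Longrightarrow> continuous_map T euclideanreal (c j)"
    and hull: "\<And>A w g. \<lbrakk>finite (A::nat set); \<And>a. a \<in> A \<Longrightarrow> 0 \<le> w a; sum w A = 1; g ` A \<subseteq> S\<rbrakk>
        \<Longrightarrow> \<exists>p\<in>S. \<forall>j\<in>J. c j p = (\<Sum>a\<in>A. w a * c j (g a))"
    and fS: "\<And>x. x \<in> S \<Longrightarrow> f x \<in> S"
  obtains x where "x \<in> S"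
    and "\<And>e. 0 < e \<Longrightarrow> \<exists>(A::nat set) w z. finite A \<and> sum w A = 1 \<and>
      (\<forall>a\<in>A. 0 \<le> w a \<and> z a \<in> S \<and> cdist c J (z a) x < e) \<and>
      (\<Sum>j\<in>J. \<bar>c j x - (\<Sum>a\<in>A. w a * c j (f (z a)))\<bar>) < e"
proof -
  define P where "P x e \<longleftrightarrow> (\<exists>(A::nat set) w z. finite A \<and> sum w A = 1 \<and>
      (\<forall>a\<in>A. 0 \<le> w a \<and> z a \<in> S \<and> cdist c J (z a) x < e) \<and>
      (\<Sum>j\<in>J. \<bar>c j x - (\<Sum>a\<in>A. w a * c j (f (z a)))\<bar>) < e)" for x e
  have "\<exists>x\<in>S. \<forall>e>0. P x e"
  \<comment> \<open>Compactness replaces a limit argument. If every \<open>x\<close> fails at some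
    radius \<open>e x\<close>, finitely many balls of half that radius cover \<open>S\<close>. An
    approximate fixed point at the scale of the least half radius lies in one of them, and the
    triangle inequality yields \<open>P\<close> at its centre.\<close>
  proof (rule ccontr)
    assume "\<not> ?thesis"
    then obtain e where e: "\<And>x. x \<in> S \<Longrightarrow> 0 < e x" "\<And>x. x \<in> S \<Longrightarrow> \<not> P x (e x)"
      by metis
    obtain F where F: "finite F" "F \<subseteq> S" "\<And>x. x \<in> S \<Longrightarrow> \<exists>y\<in>F. cdist c J x y < e y / 2"
      using compactin_finite_cdist_cover[of T S J c "\<lambda>x. e x / 2"] S(1) J c e(1) by auto
    define \<epsilon> where "\<epsilon> = Min ((\<lambda>y. e y / 2) ` F)"
    have "F \<noteq> {}"
      using S(2) F(3) by blast
    then have \<epsilon>: "0 < \<epsilon>" "\<And>y. y \<in> F \<Longrightarrow> \<epsilon> \<le> e y / 2"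
      unfolding \<epsilon>_def using F(1,2) e(1) by (auto simp del: le_divide_eq_numeral1 intro: Min_le)
    obtain G where G: "finite G" "G \<subseteq> S" "\<And>x. x \<in> S \<Longrightarrow> \<exists>y\<in>G. cdist c J x y < \<epsilon>"
      using compactin_finite_cdist_cover[of T S J c "\<lambda>x. \<epsilon>"] S(1) J c \<epsilon>(1) by auto
    obtain z and m :: nat where z: "G = z ` {i. i < m}"
      using finite_imp_nat_seg_image_inj_on[OF G(1)] by blast
    obtain x w where x: "x \<in> S" and w: "\<And>i. i < m \<Longrightarrow> 0 \<le> w i" "sum w {..<m} = 1"
      and near: "\<And>i. i < m \<Longrightarrow> 0 < w i \<Longrightarrow> cdist c J x (z i) < \<epsilon>"
      and cx: "\<And>j. j \<in> J \<Longrightarrow> c j x = (\<Sum>i<m. w i * c j (f (z i)))"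
    proof (rule approximate_fixpoint_of_net[of S J c m z \<epsilon> f])
      show "\<exists>i<m. cdist c J x (z i) < \<epsilon>" if "x \<in> S" for x
        using G(3)[OF that] z by auto
    qed (use S hull fS G z in auto)
    obtain y where y: "y \<in> F" "cdist c J x y < e y / 2"
      using F x by blast
    \<comment> \<open>Only indices of positive weight are known to be close to \<open>x\<close>;
      dropping the others leaves the sums unchanged.\<close>
    define A where "A = {i. i < m \<and> 0 < w i}"
    have sumA: "(\<Sum>i\<in>A. w i * h i) = (\<Sum>i<m. w i * h i)" for h
      unfolding A_def using w(1) by (intro sum.mono_neutral_left) force+
    have "P y (e y)"
      unfolding P_def
    proof (intro exI conjI ballI)
      show "finite A" by (simp add: A_def)
      show "sum w A = 1" using sumA[of "\<lambda>_. 1"] w(2) by simp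
      show "(\<Sum>j\<in>J. \<bar>c j y - (\<Sum>a\<in>A. w a * c j (f (z a)))\<bar>) < e y"
      proof -
        have "(\<Sum>j\<in>J. \<bar>c j y - (\<Sum>a\<in>A. w a * c j (f (z a)))\<bar>) = cdist c J y x"
          unfolding cdist_def sumA using cx by (intro sum.cong) auto
        then show ?thesis
          using y e(1)[of y] F(2) by (auto simp: cdist_commute)
      qed
      fix i assume i: "i \<in> A"
      show "0 \<le> w i" "z i \<in> S" using i w(1) z G(2) by (auto simp: A_def)
      have "cdist c J x (z i) < e y / 2"
        using near i \<epsilon>(2)[OF y(1)] by (fastforce simp: A_def)
      then show "cdist c J (z i) y < e y"
        using y(2) cdist_triangle[of c J "z i" y x] by (simp add: cdist_commute)
    qed
    then show False
      using e(2) y F by blast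
  qed
  then show thesis
    using that unfolding P_def by blast
qed

subsection \<open>Coordinate distances, convexity and open graphs\<close>

definition vdist :: "nat \<Rightarrow> vec \<Rightarrow> vec \<Rightarrow> real" where
  "vdist k x y = (\<Sum>i<k. \<bar>x i - y i\<bar>)"

definition pdist :: "'i set \<Rightarrow> ('i \<Rightarrow> nat) \<Rightarrow> ('i \<Rightarrow> vec) \<Rightarrow> ('i \<Rightarrow> vec) \<Rightarrow> real" where
  "pdist I n x y = (\<Sum>\<nu>\<in>I. vdist (n \<nu>) (x \<nu>) (y \<nu>))"

lemma vdist_nonneg: "0 \<le> vdist k x y"
  by (simp add: vdist_def sum_nonneg)

lemma vdist_triangle: "vdist k x z \<le> vdist k x y + vdist k y z"
  unfolding vdist_def sum.distrib[symmetric] by (rule sum_mono) simp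

lemma vdist_commute: "vdist k x y = vdist k y x"
  by (simp add: vdist_def abs_minus_commute)

lemma abs_diff_le_vdist: "i < k \<Longrightarrow> \<bar>x i - y i\<bar> \<le> vdist k x y"
  unfolding vdist_def by (rule member_le_sum) auto

lemma pdist_triangle: "pdist I n x z \<le> pdist I n x y + pdist I n y z"
  unfolding pdist_def sum.distrib[symmetric] by (rule sum_mono) (rule vdist_triangle)

lemma pdist_commute: "pdist I n x y = pdist I n y x"
  by (simp add: pdist_def vdist_commute)

lemma vdist_le_pdist: "finite I \<Longrightarrow> \<nu> \<in> I \<Longrightarrow> vdist (n \<nu>) (x \<nu>) (y \<nu>) \<le> pdist I n x y"
  unfolding pdist_def by (rule member_le_sum) (auto simp: vdist_nonneg)

lemma pdist_restrict_le: "finite I \<Longrightarrow> L \<subseteq> I \<Longrightarrow> pdist L n (restrict x L) (restrict y L) \<le> pdist I n x y"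
  unfolding pdist_def by (rule sum_mono2[THEN order_trans[rotated]]) (auto simp: vdist_nonneg)

lemma pdist_eq_cdist:
  assumes "finite I"
  shows "pdist I n x y = cdist (\<lambda>(\<nu>, k) x. x \<nu> k) (SIGMA \<nu>:I. {..<n \<nu>}) x y"
  unfolding pdist_def vdist_def cdist_def
  using assms by (subst sum.Sigma) (auto intro: sum.cong)

text \<open>The minimum of finitely many radii works, since \<open>P\<close> passes to smaller
  positive ones. This turns basic open boxes into balls.\<close>

lemma finite_common_radius:
  fixes P :: "'a \<Rightarrow> real \<Rightarrow> bool"
  assumes "finite A" and "\<And>a. a \<in> A \<Longrightarrow> \<exists>e>0. P a e"
    and "\<And>a d e. P a e \<Longrightarrow> 0 < d \<Longrightarrow> d \<le> e \<Longrightarrow> P a d"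
  shows "\<exists>e>0. \<forall>a\<in>A. P a e"
  using assms(1,2)
proof (induction rule: finite_induct)
  case empty
  show ?case by (auto intro: exI[of _ 1])
next
  case (insert a A)
  then obtain d e where "0 < d" "\<forall>a\<in>A. P a d" "0 < e" "P a e"
    by (metis insertCI)
  then show ?case
    using assms(3) by (intro exI[of _ "min d e"]) auto
qed

section \<open>Distance balls and the product topologies\<close>

lemma continuous_map_Euclidean_space_coordinate:
  "continuous_map (Euclidean_space k) euclideanreal (\<lambda>x. x i)"
  unfolding Euclidean_space_def
  by (intro continuous_map_from_subtopology continuous_map_product_coordinates) simp

lemma openin_vdist_ball: "openin (Euclidean_space k) {z \<in> topspace (Euclidean_space k). vdist k z y < e}"
proof -
  have "continuous_map (Euclidean_space k) euclideanreal (\<lambda>z. vdist k z y)"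
    unfolding vdist_def by (intro continuous_intros continuous_map_Euclidean_space_coordinate) auto
  then have "openin (Euclidean_space k) {z \<in> topspace (Euclidean_space k). vdist k z y \<in> {..<e}}"
    by (rule openin_continuous_map_preimage) auto
  then show ?thesis by simp
qed

text \<open>A basic open box restricts the first \<open>k\<close> coordinates by open sets of reals,
  and the remaining coordinates all vanish. Together with the openness of balls, this shows that
  \<open>vdist k\<close> induces the topology.\<close>

lemma openin_Euclidean_space_contains_vdist_ball:
  assumes "openin (Euclidean_space k) W" "y \<in> W"
  shows "\<exists>e>0. \<forall>z\<in>topspace (Euclidean_space k). vdist k z y < e \<longrightarrow> z \<in> W"
proof -
  obtain V where V: "openin (powertop_real UNIV) V" "W = V \<inter> {x. \<forall>i\<ge>k. x i = 0}"
    using assms(1) by (auto simp: Euclidean_space_def openin_subtopology)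
  obtain U where U: "y \<in> PiE UNIV U" "\<And>i. open (U i)" "PiE UNIV U \<subseteq> V"
    using product_topology_open_contains_basis[OF V(1), of y] V(2) assms(2) by auto
  have "\<exists>e>0. \<forall>i\<in>{..<k}. \<forall>t. \<bar>t - y i\<bar> < e \<longrightarrow> t \<in> U i"
  proof (rule finite_common_radius)
    show "\<exists>e>0. \<forall>t. \<bar>t - y i\<bar> < e \<longrightarrow> t \<in> U i" for i
      using U(1) U(2)[of i] unfolding open_dist by (auto simp: dist_real_def PiE_iff)
  qed auto
  then obtain e where e: "0 < e" "\<And>i t. i < k \<Longrightarrow> \<bar>t - y i\<bar> < e \<Longrightarrow> t \<in> U i"
    by auto
  have "z \<in> W" if z: "z \<in> topspace (Euclidean_space k)" "vdist k z y < e" for z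
  proof -
    have "z i \<in> U i" for i
    proof (cases "i < k")
      case True
      then show ?thesis using e z(2) abs_diff_le_vdist[of i k z y] by fastforce
    next
      case False
      then have "z i = y i" using z(1) assms(2) V(2) by (simp add: topspace_Euclidean_space)
      then show ?thesis using U(1) by auto
    qed
    then show ?thesis using U(3) V(2) z(1) by (auto simp: topspace_Euclidean_space)
  qed
  then show ?thesis using e(1) by blast
qed

lemma openin_product_contains_pdist_ball:
  assumes "finite I" "openin (product_topology (\<lambda>\<nu>. Euclidean_space (n \<nu>)) I) W" "x \<in> W"
  shows "\<exists>e>0. \<forall>z\<in>topspace (product_topology (\<lambda>\<nu>. Euclidean_space (n \<nu>)) I).
    pdist I n z x < e \<longrightarrow> z \<in> W"
proof -
  obtain U where U: "x \<in> PiE I U" "\<And>i. openin (Euclidean_space (n i)) (U i)" "PiE I U \<subseteq> W"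
    using product_topology_open_contains_basis[OF assms(2,3)] by auto
  have "\<exists>e>0. \<forall>i\<in>I. \<forall>z\<in>topspace (Euclidean_space (n i)). vdist (n i) z (x i) < e \<longrightarrow> z \<in> U i"
    by (rule finite_common_radius[OF assms(1)])
      (use U openin_Euclidean_space_contains_vdist_ball in \<open>auto simp: PiE_iff\<close>)
  then obtain e where "0 < e"
    and e: "\<And>i z. i \<in> I \<Longrightarrow> z \<in> topspace (Euclidean_space (n i)) \<Longrightarrow> vdist (n i) z (x i) < e \<Longrightarrow> z \<in> U i"
    by blast
  have "z \<in> W" if "z \<in> topspace (product_topology (\<lambda>\<nu>. Euclidean_space (n \<nu>)) I)" "pdist I n z x < e" for z
  proof -
    have "z i \<in> U i" if "i \<in> I" for i
      using e[OF that] \<open>z \<in> topspace _\<close> \<open>pdist I n z x < e\<close> vdist_le_pdist[OF assms(1) that, of n z x] that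
      by (auto simp: PiE_iff)
    then have "z \<in> PiE I U"
      using that(1) by (auto simp: PiE_iff)
    then show ?thesis
      using U(3) by blast
  qed
  then show ?thesis using \<open>0 < e\<close> by blast
qed

section \<open>Convex sets, open graphs and margins\<close>

lemma fconvex_sum:
  assumes "fconvex C" "finite A" "\<And>a. a \<in> A \<Longrightarrow> 0 \<le> w a" "sum w A = 1" "\<And>a. a \<in> A \<Longrightarrow> g a \<in> C"
  shows "(\<lambda>i. \<Sum>a\<in>A. w a * g a i) \<in> C"
  using assms(2-)
proof (induction arbitrary: w rule: finite_induct)
  case empty
  then show ?case by simp
next
  case (insert a A)
  have s: "sum w A = 1 - w a"
    using insert by simp
  show ?case
  proof (cases "w a = 1")
    \<comment> \<open>The induction divides the other weights by \<open>1 - w a\<close>, so full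
      weight on \<open>a\<close> is treated apart.\<close>
    case True
    then have "w b = 0" if "b \<in> A" for b
      using s that insert sum_nonneg_eq_0_iff[of A w] by auto
    then have "(\<lambda>i. \<Sum>b\<in>insert a A. w b * g b i) = g a"
      using insert True by auto
    then show ?thesis using insert by simp
  next
    case False
    have "0 \<le> sum w A"
      using insert.prems(1) by (intro sum_nonneg) auto
    then have lt: "w a < 1"
      using s False by simp
    have "(\<lambda>i. \<Sum>b\<in>A. w b / (1 - w a) * g b i) \<in> C"
      using insert lt s by (intro insert.IH) (auto simp: sum_divide_distrib[symmetric])
    then have "(\<lambda>i. (1 - w a) * (\<Sum>b\<in>A. w b / (1 - w a) * g b i) + w a * g a i) \<in> C"
      using \<open>fconvex C\<close> insert lt unfolding fconvex_def by auto
    moreover have "(\<lambda>i. (1 - w a) * (\<Sum>b\<in>A. w b / (1 - w a) * g b i) + w a * g a i)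
        = (\<lambda>i. \<Sum>b\<in>insert a A. w b * g b i)"
      using insert lt by (auto simp: sum_distrib_left)
    ultimately show ?thesis by simp
  qed
qed

text \<open>Induction on the dimension: the slice of \<open>C\<close> at \<open>c k = w k\<close> is
  convex and again meets every open orthant about \<open>w\<close>, as a segment between points on
  opposite sides of it crosses it. The set \<open>A\<close> codes a sign pattern. Meeting finitely
  many open orthants is a membership test that survives small perturbations.\<close>

lemma fconvex_meeting_all_orthants:
  assumes "fconvex C" and "\<And>c i. c \<in> C \<Longrightarrow> k \<le> i \<Longrightarrow> c i = w i"
    and "\<And>A. \<exists>c\<in>C. \<forall>i<k. (i \<in> A \<longrightarrow> w i < c i) \<and> (i \<notin> A \<longrightarrow> c i < w i)"
  shows "w \<in> C"
  using assms
proof (induction k arbitrary: C)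
  case 0
  then obtain c where "c \<in> C" "\<And>i. c i = w i" by auto
  then have "c = w" by auto
  then show ?case using \<open>c \<in> C\<close> by simp
next
  case (Suc k)
  have "w \<in> {c \<in> C. c k = w k}"
  proof (rule Suc.IH)
    show "fconvex {c \<in> C. c k = w k}"
      using Suc.prems(1) unfolding fconvex_def by (auto simp: algebra_simps)
    show "c i = w i" if "c \<in> {c \<in> C. c k = w k}" "k \<le> i" for c i
      using that Suc.prems(2)[of c i] by (cases "i = k") auto
    show "\<exists>c\<in>{c \<in> C. c k = w k}. \<forall>i<k. (i \<in> A \<longrightarrow> w i < c i) \<and> (i \<notin> A \<longrightarrow> c i < w i)" for A
    proof -
      obtain c where c: "c \<in> C" "w k < c k" "\<forall>i<k. (i \<in> A \<longrightarrow> w i < c i) \<and> (i \<notin> A \<longrightarrow> c i < w i)"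
        using Suc.prems(3)[of "insert k A"] by fastforce
      obtain d where d: "d \<in> C" "d k < w k" "\<forall>i<k. (i \<in> A \<longrightarrow> w i < d i) \<and> (i \<notin> A \<longrightarrow> d i < w i)"
        using Suc.prems(3)[of "A - {k}"] by fastforce
      \<comment> \<open>\<open>c\<close> and \<open>d\<close> have the same signs relative to
        \<open>w\<close> below \<open>k\<close> and opposite ones at \<open>k\<close>;
        \<open>u\<close> is the parameter at which the segment crosses the hyperplane.\<close>
      define u where "u = (c k - w k) / (c k - d k)"
      have u: "0 < u" "u < 1" "u * (c k - d k) = c k - w k"
        using c(2) d(2) by (auto simp: u_def field_simps)
      define p where "p = (\<lambda>i. (1 - u) * c i + u * d i)"
      have "p \<in> C"
        using Suc.prems(1) c(1) d(1) u unfolding fconvex_def p_def by auto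
      moreover have "p k = w k"
        using u(3) by (simp add: p_def algebra_simps)
      moreover have "w i < p i" if "w i < c i" "w i < d i" for i
      proof -
        have "(1 - u) * w i + u * w i < p i"
          unfolding p_def using that u by (intro add_strict_mono mult_strict_left_mono) auto
        then show ?thesis by (simp add: algebra_simps)
      qed
      moreover have "p i < w i" if "c i < w i" "d i < w i" for i
      proof -
        have "p i < (1 - u) * w i + u * w i"
          unfolding p_def using that u by (intro add_strict_mono mult_strict_left_mono) auto
        then show ?thesis by (simp add: algebra_simps)
      qed
      ultimately show ?thesis
        using c(3) d(3) by blast
    qed
  qed
  then show ?case by simp
qed

text \<open>The vertices of a small cube about \<open>y\<close> lie in \<open>U x\<close>. Lower
  hemicontinuity keeps points of \<open>U x'\<close> near each of them, so \<open>U x'\<close> meets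
  all orthants about every \<open>y'\<close> near \<open>y\<close> and contains \<open>y'\<close> by
  convexity.\<close>

lemma lhc_convex_open_values_open_graph:
  assumes U: "lhc T (Euclidean_space k) U"
    and cvx: "\<And>x. x \<in> topspace T \<Longrightarrow> fconvex (U x)"
    and opn: "\<And>x. x \<in> topspace T \<Longrightarrow> openin (Euclidean_space k) (U x)"
    and x: "x \<in> topspace T" and y: "y \<in> U x"
  obtains V e where "openin T V" "x \<in> V" "0 < e"
    and "\<And>x' y'. x' \<in> V \<Longrightarrow> y' \<in> topspace (Euclidean_space k) \<Longrightarrow> vdist k y' y < e \<Longrightarrow> y' \<in> U x'"
proof -
  let ?E = "topspace (Euclidean_space k)"
  have UE: "U x \<subseteq> ?E" if "x \<in> topspace T" for x
    using opn[OF that] by (rule openin_subset)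
  obtain r where r: "0 < r" "\<And>z. z \<in> ?E \<Longrightarrow> vdist k z y < r \<Longrightarrow> z \<in> U x"
    using openin_Euclidean_space_contains_vdist_ball[OF opn[OF x] y] by blast
  \<comment> \<open>The vertices are at l1 distance \<open>k * e\<close> from \<open>y\<close>; the
    summand 1 makes this less than \<open>r\<close> and covers \<open>k = 0\<close>.\<close>
  define e where "e = r / (real k + 1)"
  have e: "0 < e" "real k * e < r"
    using r(1) by (auto simp: e_def field_simps)
  define p where "p A = (\<lambda>i. if i < k then (if i \<in> A then y i + e else y i - e) else 0)" for A
  have pE: "p A \<in> ?E" for A
    by (simp add: p_def topspace_Euclidean_space)
  have pU: "p A \<in> U x" for A
  proof -
    have "vdist k (p A) y = (\<Sum>i<k. e)"
      unfolding vdist_def using e(1) by (intro sum.cong) (auto simp: p_def)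
    then show ?thesis using r(2) pE e(2) by simp
  qed
  have "\<exists>V. openin T V \<and> x \<in> V \<and> (\<forall>x'\<in>V. U x' \<inter> {z \<in> ?E. vdist k z (p A) < e / 2} \<noteq> {})" for A
  proof -
    have "p A \<in> {z \<in> ?E. vdist k z (p A) < e / 2} \<inter> U x"
      using pE pU e(1) by (simp add: vdist_def)
    then have "{z \<in> ?E. vdist k z (p A) < e / 2} \<inter> U x \<noteq> {}" by blast
    then show ?thesis
      using U x openin_vdist_ball[of k "p A" "e / 2"] unfolding lhc_def lhc_at_def by blast
  qed
  then obtain V where V: "\<And>A. openin T (V A)" "\<And>A. x \<in> V A"
    "\<And>A x'. x' \<in> V A \<Longrightarrow> \<exists>z\<in>U x'. vdist k z (p A) < e / 2"
    by (metis (no_types, lifting) disjoint_iff mem_Collect_eq)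
  show thesis
  \<comment> \<open>Two errors below \<open>e / 2\<close> cannot reverse the sign of a difference
    \<open>e\<close>. Restricting to subsets of \<open>{..<k}\<close> keeps the intersection finite,
    hence open.\<close>
  proof (rule that[of "\<Inter>(V ` Pow {..<k})" "e / 2"])
    show op: "openin T (\<Inter>(V ` Pow {..<k}))"
      using V(1) by (intro openin_Inter) auto
    show "x \<in> \<Inter>(V ` Pow {..<k})" "0 < e / 2"
      using V(2) e(1) by auto
    fix x' y' assume x': "x' \<in> \<Inter>(V ` Pow {..<k})" and y': "y' \<in> ?E" "vdist k y' y < e / 2"
    have x'T: "x' \<in> topspace T"
      using x' openin_subset[OF op] by blast
    show "y' \<in> U x'"
    proof (rule fconvex_meeting_all_orthants[OF cvx[OF x'T]])
      show "c i = y' i" if "c \<in> U x'" "k \<le> i" for c i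
        using UE[OF x'T] that y'(1) by (auto simp: topspace_Euclidean_space subset_iff)
      show "\<exists>c\<in>U x'. \<forall>i<k. (i \<in> A \<longrightarrow> y' i < c i) \<and> (i \<notin> A \<longrightarrow> c i < y' i)" for A
      proof -
        obtain z where z: "z \<in> U x'" "vdist k z (p (A \<inter> {..<k})) < e / 2"
          using V(3)[of x' "A \<inter> {..<k}"] x' by blast
        have d: "\<bar>z i - p (A \<inter> {..<k}) i\<bar> < e / 2" "\<bar>y' i - y i\<bar> < e / 2" if "i < k" for i
          using z(2) y'(2) abs_diff_le_vdist[OF that] by (meson le_less_trans)+
        have "(i \<in> A \<longrightarrow> y' i < z i) \<and> (i \<notin> A \<longrightarrow> z i < y' i)" if "i < k" for i
        proof (cases "i \<in> A")
          case True
          then have "p (A \<inter> {..<k}) i = y i + e" using that by (simp add: p_def)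
          then show ?thesis using d[OF that] True by arith
        next
          case False
          then have "p (A \<inter> {..<k}) i = y i - e" using that by (simp add: p_def)
          then show ?thesis using d[OF that] False by arith
        qed
        with z(1) show ?thesis by blast
      qed
    qed
  qed
qed

text \<open>The supremum of the available margins need not be attained, but some point exceeds half
  of it. The cap 1 keeps the supremum finite; if no margin is available, any point of
  \<open>C\<close> serves.\<close>

lemma near_maximal_margin:
  fixes G :: "real \<Rightarrow> 'a \<Rightarrow> bool"
  assumes "C \<noteq> {}" and mono: "\<And>r s y. G s y \<Longrightarrow> r \<le> s \<Longrightarrow> G r y"
  shows "\<exists>y\<in>C. \<forall>r. 0 < r \<longrightarrow> r \<le> 1 \<longrightarrow> (\<exists>y'\<in>C. G r y') \<longrightarrow> G (r / 2) y"
proof -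
  define R where "R = {r. 0 < r \<and> r \<le> 1 \<and> (\<exists>y\<in>C. G r y)}"
  show ?thesis
  proof (cases "R = {}")
    case True
    then show ?thesis using assms(1) by (auto simp: R_def)
  next
    case False
    have bdd: "bdd_above R" by (auto simp: R_def intro: bdd_aboveI[of _ 1])
    have up: "r \<le> Sup R" if "r \<in> R" for r
      using cSup_upper[OF that bdd] .
    have "0 < Sup R"
      using False up by (fastforce simp: R_def)
    then obtain s where "s \<in> R" "Sup R / 2 < s"
      using less_cSup_iff[OF False bdd, of "Sup R / 2"] by auto
    then obtain y where "y \<in> C" "G s y" by (auto simp: R_def)
    moreover have "r / 2 \<le> s" if "r \<in> R" for r
      using up[OF that] \<open>Sup R / 2 < s\<close> by simp
    ultimately have "G (r / 2) y" if "r \<in> R" for r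
      using mono that by blast
    then show ?thesis
      using \<open>y \<in> C\<close> by (auto simp: R_def)
  qed
qed

text \<open>With \<open>L = I - {\<nu>}\<close>, neighbourhoods in the domain of
  \<open>K \<nu>\<close> become balls of full profiles, so that all hemicontinuity is measured by
  \<open>pdist\<close>.\<close>

lemma openin_subproduct_contains_pdist_ball:
  assumes "finite I" "L \<subseteq> I" and X: "\<And>\<nu>. \<nu> \<in> I \<Longrightarrow> X \<nu> \<subseteq> topspace (Euclidean_space (n \<nu>))"
    and Q: "openin (subtopology (product_topology (\<lambda>j. Euclidean_space (n j)) L) (PiE L X)) Q"
    and x: "restrict x L \<in> Q"
  obtains e where "0 < e" and "\<And>z. z \<in> PiE I X \<Longrightarrow> pdist I n z x < e \<Longrightarrow> restrict z L \<in> Q"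
proof -
  obtain W where W: "openin (product_topology (\<lambda>j. Euclidean_space (n j)) L) W" "Q = W \<inter> PiE L X"
    using Q by (auto simp: openin_subtopology)
  have finL: "finite L" using assms(1,2) finite_subset by blast
  obtain e where e: "0 < e" "\<And>z. z \<in> topspace (product_topology (\<lambda>j. Euclidean_space (n j)) L) \<Longrightarrow>
      pdist L n z (restrict x L) < e \<Longrightarrow> z \<in> W"
    using openin_product_contains_pdist_ball[OF finL W(1), of "restrict x L"] x W(2) by auto
  show thesis
  proof (rule that[OF e(1)])
    fix z assume z: "z \<in> PiE I X" "pdist I n z x < e"
    have zL: "restrict z L \<in> PiE L X"
      using z(1) assms(2) by (auto simp: PiE_iff)
    moreover have "restrict z L \<in> topspace (product_topology (\<lambda>j. Euclidean_space (n j)) L)"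
      using zL X assms(2) by (fastforce simp: PiE_iff)
    moreover have "pdist L n (restrict z L) (restrict x L) < e"
      using pdist_restrict_le[OF assms(1,2), of n z x] z(2) by simp
    ultimately show "restrict z L \<in> Q"
      using e(2) W(2) by blast
  qed
qed

text \<open>\<open>vdist\<close> is jointly convex in its two arguments. Such neighbourhoods trap
  convex combinations of feasible points at nearby profiles.\<close>

lemma fconvex_vdist_neighbourhood:
  assumes "fconvex C"
  shows "fconvex {y \<in> topspace (Euclidean_space k). \<exists>y'\<in>C. vdist k y y' < e}"
  unfolding fconvex_def
proof (intro ballI allI impI)
  fix x y and u :: real
  assume x: "x \<in> {y \<in> topspace (Euclidean_space k). \<exists>y'\<in>C. vdist k y y' < e}"
    and y: "y \<in> {y \<in> topspace (Euclidean_space k). \<exists>y'\<in>C. vdist k y y' < e}" and u: "0 \<le> u \<and> u \<le> 1"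
  obtain x' y' where x': "x' \<in> C" "vdist k x x' < e" and y': "y' \<in> C" "vdist k y y' < e"
    using x y by blast
  have "vdist k (\<lambda>i. (1 - u) * x i + u * y i) (\<lambda>i. (1 - u) * x' i + u * y' i)
      \<le> (1 - u) * vdist k x x' + u * vdist k y y'"
    unfolding vdist_def sum_distrib_left sum.distrib[symmetric]
  proof (rule sum_mono)
    fix i
    have "\<bar>(1 - u) * x i + u * y i - ((1 - u) * x' i + u * y' i)\<bar>
        = \<bar>(1 - u) * (x i - x' i) + u * (y i - y' i)\<bar>"
      by (simp add: algebra_simps)
    also have "\<dots> \<le> (1 - u) * \<bar>x i - x' i\<bar> + u * \<bar>y i - y' i\<bar>"
      using u abs_triangle_ineq[of "(1 - u) * (x i - x' i)" "u * (y i - y' i)"] by (simp add: abs_mult)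
    finally show "\<bar>(1 - u) * x i + u * y i - ((1 - u) * x' i + u * y' i)\<bar>
        \<le> (1 - u) * \<bar>x i - x' i\<bar> + u * \<bar>y i - y' i\<bar>" .
  qed
  also have "\<dots> < e"
    using convex_bound_lt[OF x'(2) y'(2), of "1 - u" u] u by simp
  finally have "vdist k (\<lambda>i. (1 - u) * x i + u * y i) (\<lambda>i. (1 - u) * x' i + u * y' i) < e" .
  moreover have "(\<lambda>i. (1 - u) * x' i + u * y' i) \<in> C"
    using assms x'(1) y'(1) u unfolding fconvex_def by blast
  ultimately show "(\<lambda>i. (1 - u) * x i + u * y i) \<in> {y \<in> topspace (Euclidean_space k). \<exists>y'\<in>C. vdist k y y' < e}"
    using x y by (auto simp: topspace_Euclidean_space)
qed

lemma openin_vdist_neighbourhood: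
  "openin (Euclidean_space k) {y \<in> topspace (Euclidean_space k). \<exists>y'\<in>C. vdist k y y' < e}"
proof -
  have "{y \<in> topspace (Euclidean_space k). \<exists>y'\<in>C. vdist k y y' < e}
      = (\<Union>y'\<in>C. {y \<in> topspace (Euclidean_space k). vdist k y y' < e})"
    by auto
  then show ?thesis
    using openin_vdist_ball by (metis (no_types, lifting) imageE openin_Union)
qed

subsection \<open>Existence of an equilibrium\<close>

theorem theorem3:
  fixes I :: "'i set" and n :: "'i \<Rightarrow> nat" and X :: "'i \<Rightarrow> (nat \<Rightarrow> real) set"
    and R :: "'i \<Rightarrow> ('i \<Rightarrow> nat \<Rightarrow> real) \<Rightarrow> ('i \<Rightarrow> nat \<Rightarrow> real) \<Rightarrow> bool"
    and K :: "'i \<Rightarrow> ('i \<Rightarrow> nat \<Rightarrow> real) \<Rightarrow> (nat \<Rightarrow> real) set"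
  assumes finI: "finite I"
    and X_ne: "\<And>\<nu>. \<nu> \<in> I \<Longrightarrow> X \<nu> \<noteq> {}"
    and X_cvx: "\<And>\<nu>. \<nu> \<in> I \<Longrightarrow> fconvex (X \<nu>)"
    and X_cpt: "\<And>\<nu>. \<nu> \<in> I \<Longrightarrow> compactin (Euclidean_space (n \<nu>)) (X \<nu>)"
    and K_cont: "\<And>\<nu>. \<nu> \<in> I \<Longrightarrow>
       hcont (subtopology (product_topology (\<lambda>j. Euclidean_space (n j)) (I - {\<nu>})) (PiE (I - {\<nu>}) X))
             (Euclidean_space (n \<nu>)) (K \<nu>)"
    and K_vals: "\<And>\<nu> z. \<nu> \<in> I \<Longrightarrow> z \<in> PiE (I - {\<nu>}) X \<Longrightarrow>
       K \<nu> z \<subseteq> X \<nu> \<and> K \<nu> z \<noteq> {} \<and> closedin (Euclidean_space (n \<nu>)) (K \<nu> z) \<and> fconvex (K \<nu> z)"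
    and U_cvx_open: "\<And>\<nu> x. \<nu> \<in> I \<Longrightarrow> x \<in> topspace (prof_top I n) \<Longrightarrow>
       fconvex (Us n R \<nu> x) \<and> openin (Euclidean_space (n \<nu>)) (Us n R \<nu> x)"
    and U_lhc: "\<And>\<nu>. \<nu> \<in> I \<Longrightarrow> lhc (prof_top I n) (Euclidean_space (n \<nu>)) (Us n R \<nu>)"
  shows "\<exists>xh. is_GNE I X R K xh"
proof -

  \<comment> \<open>Hemicontinuity of the constraints in terms of full profiles\<close>
  let ?E = "\<lambda>\<nu>. topspace (Euclidean_space (n \<nu>))"
  define T where "T = prof_top I n"
  define S where "S = PiE I X"
  define J where "J = (SIGMA \<nu>:I. {..<n \<nu>})"
  define c :: "'i \<times> nat \<Rightarrow> ('i \<Rightarrow> vec) \<Rightarrow> real" where "c = (\<lambda>(\<nu>, k) x. x \<nu> k)"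
  define KK where "KK \<nu> x = K \<nu> (restrict x (I - {\<nu>}))" for \<nu> x
  have XE: "X \<nu> \<subseteq> ?E \<nu>" if "\<nu> \<in> I" for \<nu>
    using X_cpt[OF that] by (rule compactin_subset_topspace)
  have ST: "S \<subseteq> topspace T"
    using XE by (auto simp: S_def T_def prof_top_def PiE_iff)
  have restr: "restrict x (I - {\<nu>}) \<in> PiE (I - {\<nu>}) X" if "x \<in> S" for x \<nu>
    using that by (auto simp: S_def PiE_iff)
  have KK: "KK \<nu> x \<subseteq> X \<nu>" "KK \<nu> x \<noteq> {}" "closedin (Euclidean_space (n \<nu>)) (KK \<nu> x)" "fconvex (KK \<nu> x)"
    if "\<nu> \<in> I" "x \<in> S" for \<nu> x
    using K_vals[OF that(1) restr[OF that(2)]] by (auto simp: KK_def)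
  have Kdom: "restrict x (I - {\<nu>}) \<in> topspace (subtopology (product_topology
      (\<lambda>j. Euclidean_space (n j)) (I - {\<nu>})) (PiE (I - {\<nu>}) X))" if "x \<in> S" for x \<nu>
    using restr[OF that, of \<nu>] XE by (fastforce simp: PiE_iff)
  have K_uhc: "\<exists>e>0. \<forall>z\<in>S. pdist I n z x < e \<longrightarrow> KK \<nu> z \<subseteq> V"
    if h: "\<nu> \<in> I" "x \<in> S" "openin (Euclidean_space (n \<nu>)) V" "KK \<nu> x \<subseteq> V" for \<nu> x V
  proof -
    obtain Q where Q: "openin (subtopology (product_topology (\<lambda>j. Euclidean_space (n j)) (I - {\<nu>}))
        (PiE (I - {\<nu>}) X)) Q" "restrict x (I - {\<nu>}) \<in> Q" "\<And>z. z \<in> Q \<Longrightarrow> K \<nu> z \<subseteq> V"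
      using K_cont[OF h(1)] Kdom[OF h(2)] h(3,4) unfolding hcont_def uhc_at_def KK_def by meson
    show ?thesis
      using openin_subproduct_contains_pdist_ball[OF finI _ XE Q(1,2)] Q(3) unfolding S_def KK_def
      by (metis Diff_subset)
  qed
  have K_lhc: "\<exists>e>0. \<forall>z\<in>S. pdist I n z x < e \<longrightarrow> KK \<nu> z \<inter> V \<noteq> {}"
    if h: "\<nu> \<in> I" "x \<in> S" "openin (Euclidean_space (n \<nu>)) V" "V \<inter> KK \<nu> x \<noteq> {}" for \<nu> x V
  proof -
    obtain Q where Q: "openin (subtopology (product_topology (\<lambda>j. Euclidean_space (n j)) (I - {\<nu>}))
        (PiE (I - {\<nu>}) X)) Q" "restrict x (I - {\<nu>}) \<in> Q" "\<And>z. z \<in> Q \<Longrightarrow> K \<nu> z \<inter> V \<noteq> {}"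
      using K_cont[OF h(1)] Kdom[OF h(2)] h(3,4) unfolding hcont_def lhc_at_def KK_def by meson
    show ?thesis
      using openin_subproduct_contains_pdist_ball[OF finI _ XE Q(1,2)] Q(3) unfolding S_def KK_def
      by (metis Diff_subset)
  qed

  \<comment> \<open>\<open>(z, y)\<close> has margin \<open>r\<close> inside the graph of \<open>Us n R \<nu>\<close>.\<close>
  define G where "G \<nu> r z y \<longleftrightarrow> (\<forall>z'\<in>topspace T. \<forall>y'\<in>?E \<nu>. pdist I n z' z < r \<longrightarrow>
      vdist (n \<nu>) y' y < r \<longrightarrow> y' \<in> Us n R \<nu> z')" for \<nu> r z y
  have "\<exists>y\<in>KK \<nu> z. \<forall>r. 0 < r \<longrightarrow> r \<le> 1 \<longrightarrow> (\<exists>y'\<in>KK \<nu> z. G \<nu> r z y') \<longrightarrow> G \<nu> (r / 2) z y"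
    if "\<nu> \<in> I" "z \<in> S" for \<nu> z
    by (rule near_maximal_margin[OF KK(2)[OF that]]) (fastforce simp: G_def)
  then obtain f where fK: "\<And>\<nu> z. \<nu> \<in> I \<Longrightarrow> z \<in> S \<Longrightarrow> f \<nu> z \<in> KK \<nu> z"
    and fG: "\<And>\<nu> z r y. \<lbrakk>\<nu> \<in> I; z \<in> S; 0 < r; r \<le> 1; y \<in> KK \<nu> z; G \<nu> r z y\<rbrakk> \<Longrightarrow> G \<nu> (r / 2) z (f \<nu> z)"
    by metis

  \<comment> \<open>A near-fixed profile of the selection\<close>
  obtain xh where xh: "xh \<in> S" and near0: "\<And>e. 0 < e \<Longrightarrow> \<exists>(A::nat set) w z. finite A \<and> sum w A = 1 \<and>
      (\<forall>a\<in>A. 0 \<le> w a \<and> z a \<in> S \<and> cdist c J (z a) xh < e) \<and>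
      (\<Sum>j\<in>J. \<bar>c j xh - (\<Sum>a\<in>A. w a * c j (\<lambda>\<nu>\<in>I. f \<nu> (z a)))\<bar>) < e"
  proof (rule near_fixpoint_of_arbitrary_map[of T S J c "\<lambda>z. \<lambda>\<nu>\<in>I. f \<nu> z"])
    show "compactin T S"
      using X_cpt by (simp add: T_def S_def prof_top_def compactin_PiE)
    show "S \<noteq> {}"
      using X_ne by (simp add: S_def PiE_eq_empty_iff)
    show "finite J"
      using finI by (simp add: J_def)
    show "continuous_map T euclideanreal (c j)" if jJ: "j \<in> J" for j
    proof -
      obtain \<nu> k where j: "j = (\<nu>, k)" "\<nu> \<in> I" using jJ by (auto simp: J_def)
      have "continuous_map T euclideanreal ((\<lambda>y. y k) \<circ> (\<lambda>x. x \<nu>))"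
        unfolding T_def prof_top_def using j(2)
        by (intro continuous_map_compose[OF continuous_map_product_coordinates]
            continuous_map_Euclidean_space_coordinate)
      then show ?thesis by (simp add: c_def j o_def)
    qed
    show "(\<lambda>\<nu>\<in>I. f \<nu> z) \<in> S" if "z \<in> S" for z
      using fK KK(1) that by (fastforce simp: S_def)
    show "\<exists>p\<in>S. \<forall>j\<in>J. c j p = (\<Sum>a\<in>A. w a * c j (g a))"
      if "finite A" "\<And>a. a \<in> A \<Longrightarrow> 0 \<le> w a" "sum w A = 1" "g ` A \<subseteq> S" for A :: "nat set" and w g
    proof
      show "(\<lambda>\<nu>\<in>I. \<lambda>k. \<Sum>a\<in>A. w a * g a \<nu> k) \<in> S"
        using fconvex_sum[OF X_cvx that(1,2,3), where g = "\<lambda>a. g a \<nu>" for \<nu>] that(4)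
        by (fastforce simp: S_def)
    qed (auto simp: c_def J_def)
  qed (use that in blast)
  \<comment> \<open>The sum over all coordinates dominates the part belonging to the single player
    \<open>\<nu>\<close>.\<close>
  have near: "\<exists>(A::nat set) w z. finite A \<and> sum w A = 1 \<and>
      (\<forall>a\<in>A. 0 \<le> w a \<and> z a \<in> S \<and> pdist I n (z a) xh < e) \<and>
      vdist (n \<nu>) (xh \<nu>) (\<lambda>k. \<Sum>a\<in>A. w a * f \<nu> (z a) k) < e" if e: "0 < e" and \<nu>: "\<nu> \<in> I" for e \<nu>
  proof -
    have cp: "cdist c J x y = pdist I n x y" for x y
      by (simp add: pdist_eq_cdist[OF finI] c_def J_def)
    obtain A :: "nat set" and w z where A: "finite A" "sum w A = 1"
      "\<forall>a\<in>A. 0 \<le> w a \<and> z a \<in> S \<and> cdist c J (z a) xh < e"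
      and less: "(\<Sum>j\<in>J. \<bar>c j xh - (\<Sum>a\<in>A. w a * c j (\<lambda>\<nu>\<in>I. f \<nu> (z a)))\<bar>) < e"
      using near0[OF e] by blast
    define q where "q = (\<lambda>\<nu> k. \<Sum>a\<in>A. w a * f \<nu> (z a) k)"
    have "(\<Sum>j\<in>J. \<bar>c j xh - (\<Sum>a\<in>A. w a * c j (\<lambda>\<nu>\<in>I. f \<nu> (z a)))\<bar>) = cdist c J xh q"
      unfolding cdist_def by (rule sum.cong) (auto simp: c_def J_def q_def)
    then have "pdist I n xh q < e"
      using less by (simp add: cp)
    then have "vdist (n \<nu>) (xh \<nu>) (q \<nu>) < e"
      using vdist_le_pdist[OF finI \<nu>, of n xh q] by simp
    then show ?thesis
      using A unfolding q_def cp by blast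
  qed

  \<comment> \<open>Feasibility\<close>
  have feasible: "xh \<nu> \<in> KK \<nu> xh" if \<nu>: "\<nu> \<in> I" for \<nu>
  proof (rule ccontr)
    let ?k = "n \<nu>"
    assume "xh \<nu> \<notin> KK \<nu> xh"
    moreover have "xh \<nu> \<in> ?E \<nu>"
      using xh XE \<nu> by (auto simp: S_def)
    ultimately obtain r where r: "0 < r" "\<And>y. y \<in> ?E \<nu> \<Longrightarrow> vdist ?k y (xh \<nu>) < r \<Longrightarrow> y \<notin> KK \<nu> xh"
      using openin_Euclidean_space_contains_vdist_ball[of ?k "?E \<nu> - KK \<nu> xh" "xh \<nu>"] KK(3)[OF \<nu> xh]
      by (auto simp: closedin_def)
    \<comment> \<open>By upper hemicontinuity this convex set contains the selected points at nearby
      profiles, hence their combinations. One combination is within \<open>r / 2\<close> of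
      \<open>xh \<nu>\<close>, so a feasible point would lie within \<open>r\<close>.\<close>
    define V where "V = {y \<in> ?E \<nu>. \<exists>y'\<in>KK \<nu> xh. vdist ?k y y' < r / 2}"
    have Vop: "openin (Euclidean_space ?k) V"
      unfolding V_def by (rule openin_vdist_neighbourhood)
    have KV: "KK \<nu> xh \<subseteq> V"
      using r(1) KK(1)[OF \<nu> xh] XE[OF \<nu>] by (force simp: V_def vdist_def)
    obtain e where e: "0 < e" "\<And>z. z \<in> S \<Longrightarrow> pdist I n z xh < e \<Longrightarrow> KK \<nu> z \<subseteq> V"
      using K_uhc[OF \<nu> xh Vop KV] by blast
    obtain A :: "nat set" and w z where A: "finite A" "sum w A = 1"
      "\<And>a. a \<in> A \<Longrightarrow> 0 \<le> w a \<and> z a \<in> S \<and> pdist I n (z a) xh < min e (r / 2)"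
      and less: "vdist ?k (xh \<nu>) (\<lambda>k. \<Sum>a\<in>A. w a * f \<nu> (z a) k) < min e (r / 2)"
      using near[of "min e (r / 2)" \<nu>] e(1) r(1) \<nu> by auto
    have "(\<lambda>k. \<Sum>a\<in>A. w a * f \<nu> (z a) k) \<in> V"
    proof (rule fconvex_sum)
      show "fconvex V"
        unfolding V_def by (rule fconvex_vdist_neighbourhood[OF KK(4)[OF \<nu> xh]])
      show "f \<nu> (z a) \<in> V" if "a \<in> A" for a
        using A(3)[OF that] e(2)[of "z a"] fK[OF \<nu>, of "z a"] by auto
    qed (use A in auto)
    then obtain y where y: "y \<in> KK \<nu> xh" "vdist ?k (\<lambda>k. \<Sum>a\<in>A. w a * f \<nu> (z a) k) y < r / 2"
      by (auto simp: V_def)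
    have "vdist ?k (xh \<nu>) y < r"
      using vdist_triangle[of ?k "xh \<nu>" y "\<lambda>k. \<Sum>a\<in>A. w a * f \<nu> (z a) k"] less y(2) by simp
    then show False
      using r(2)[of y] y(1) KK(1)[OF \<nu> xh] XE[OF \<nu>] by (auto simp: vdist_commute)
  qed

  \<comment> \<open>Absence of profitable deviations\<close>
  have optimal: "\<not> strict_pref R \<nu> xh y (xh \<nu>)" if \<nu>: "\<nu> \<in> I" and y: "y \<in> KK \<nu> xh" for \<nu> y
  proof
    let ?k = "n \<nu>"
    assume "strict_pref R \<nu> xh y (xh \<nu>)"
    moreover have yE: "y \<in> ?E \<nu>"
      using y KK(1)[OF \<nu> xh] XE[OF \<nu>] by blast
    ultimately have yU: "y \<in> Us n R \<nu> xh"
      by (simp add: Us_def)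
    have xhT: "xh \<in> topspace T"
      using xh ST by blast
    have U: "fconvex (Us n R \<nu> x)" "openin (Euclidean_space ?k) (Us n R \<nu> x)" if "x \<in> topspace T" for x
      using U_cvx_open[OF \<nu>] that by (auto simp: T_def)
    obtain V d where V: "openin T V" "xh \<in> V" "0 < d"
      and VU: "\<And>x' y'. x' \<in> V \<Longrightarrow> y' \<in> ?E \<nu> \<Longrightarrow> vdist ?k y' y < d \<Longrightarrow> y' \<in> Us n R \<nu> x'"
      using lhc_convex_open_values_open_graph[of T ?k "Us n R \<nu>" xh y] U_lhc[OF \<nu>] U xhT yU
      unfolding T_def by metis
    obtain e1 where e1: "0 < e1" "\<And>z. z \<in> topspace T \<Longrightarrow> pdist I n z xh < e1 \<Longrightarrow> z \<in> V"
      using openin_product_contains_pdist_ball[OF finI, of n V xh] V unfolding T_def prof_top_def by blast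
    \<comment> \<open>The bound 1 is the cap in \<open>fG\<close>; the halving lets two successive
      errors below \<open>r\<close> stay below both \<open>d\<close> and \<open>e1\<close>.\<close>
    define r where "r = min 1 (min d e1 / 2)"
    have r: "0 < r" "r \<le> 1" "2 * r \<le> d" "2 * r \<le> e1"
      using V(3) e1(1) by (auto simp: r_def)
    have "{y' \<in> ?E \<nu>. vdist ?k y' y < r} \<inter> KK \<nu> xh \<noteq> {}"
      using yE y r(1) by (force simp: vdist_def)
    then obtain e2 where e2: "0 < e2"
      "\<And>z. z \<in> S \<Longrightarrow> pdist I n z xh < e2 \<Longrightarrow> KK \<nu> z \<inter> {y' \<in> ?E \<nu>. vdist ?k y' y < r} \<noteq> {}"
      using K_lhc[OF \<nu> xh openin_vdist_ball] by blast
    \<comment> \<open>Near \<open>xh\<close>, lower hemicontinuity provides a feasible point close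
      to \<open>y\<close>, which has margin \<open>r\<close>; the selected point then has at least
      half of it.\<close>
    have G: "G \<nu> (r / 2) z (f \<nu> z)" if z: "z \<in> S" "pdist I n z xh < e2" "pdist I n z xh < r" for z
    proof -
      obtain y1 where y1: "y1 \<in> KK \<nu> z" "vdist ?k y1 y < r"
        using e2(2)[OF z(1,2)] by blast
      have "G \<nu> r z y1"
        unfolding G_def
      proof (intro ballI impI)
        fix z' y' assume a: "z' \<in> topspace T" "y' \<in> ?E \<nu>" "pdist I n z' z < r" "vdist ?k y' y1 < r"
        have "pdist I n z' xh < e1"
          using pdist_triangle[of I n z' xh z] a(3) z(3) r(4) by simp
        moreover have "vdist ?k y' y < d"
          using vdist_triangle[of ?k y' y y1] a(4) y1(2) r(3) by simp
        ultimately show "y' \<in> Us n R \<nu> z'"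
          using VU e1(2) a(1,2) by blast
      qed
      then show ?thesis
        using fG[OF \<nu> z(1) r(1,2) y1(1)] by blast
    qed
    obtain A :: "nat set" and w z where A: "finite A" "sum w A = 1"
      "\<And>a. a \<in> A \<Longrightarrow> 0 \<le> w a \<and> z a \<in> S \<and> pdist I n (z a) xh < min e2 (r / 2)"
      and less: "vdist ?k (xh \<nu>) (\<lambda>k. \<Sum>a\<in>A. w a * f \<nu> (z a) k) < min e2 (r / 2)"
      using near[of "min e2 (r / 2)" \<nu>] e2(1) r(1) \<nu> by auto
    \<comment> \<open>Shifting every selected point by the error \<open>t\<close> makes their
      combination equal to \<open>xh \<nu>\<close>. The shift and the distance from
      \<open>z a\<close> to \<open>xh\<close> are below \<open>r / 2\<close>, so the margin places
      each shifted point in \<open>Us n R \<nu> xh\<close>.\<close>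
    define t where "t = (\<lambda>k. xh \<nu> k - (\<Sum>a\<in>A. w a * f \<nu> (z a) k))"
    have fE: "f \<nu> (z a) \<in> ?E \<nu>" if "a \<in> A" for a
      using A(3)[OF that] fK[OF \<nu>] KK(1)[OF \<nu>] XE[OF \<nu>] by blast
    have "(\<lambda>k. \<Sum>a\<in>A. w a * (f \<nu> (z a) k + t k)) \<in> Us n R \<nu> xh"
    proof (rule fconvex_sum)
      show "fconvex (Us n R \<nu> xh)" using U xhT by blast
      show "(\<lambda>k. f \<nu> (z a) k + t k) \<in> Us n R \<nu> xh" if a: "a \<in> A" for a
      proof -
        have "xh \<nu> \<in> ?E \<nu>"
          using xh XE \<nu> by (auto simp: S_def)
        then have "(\<lambda>k. f \<nu> (z a) k + t k) \<in> ?E \<nu>"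
          using fE a by (auto simp: t_def topspace_Euclidean_space)
        moreover have "vdist ?k (\<lambda>k. f \<nu> (z a) k + t k) (f \<nu> (z a)) < r / 2"
          using less by (simp add: vdist_def t_def)
        moreover have "pdist I n xh (z a) < r / 2"
          using A(3)[OF a] by (simp add: pdist_commute)
        ultimately show ?thesis
          using G[of "z a"] A(3)[OF a] r(1) xhT unfolding G_def by auto
      qed
    qed (use A in auto)
    moreover have "(\<Sum>a\<in>A. w a * (f \<nu> (z a) k + t k)) = xh \<nu> k" for k
    proof -
      have "(\<Sum>a\<in>A. w a * (f \<nu> (z a) k + t k)) = (\<Sum>a\<in>A. w a * f \<nu> (z a) k) + sum w A * t k"
        by (simp add: distrib_left sum.distrib sum_distrib_right)
      then show ?thesis by (simp add: A(2) t_def)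
    qed
    ultimately show False
      by (simp add: Us_def strict_pref_def)
  qed

  have "is_GNE I X R K xh"
    using xh feasible optimal unfolding is_GNE_def S_def KK_def by blast
  then show ?thesis by blast
qed

end
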